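(* Let $G$ be a $d$-regular graph with $|V(G)|$ even, and let $D_d\subseteq[0,1]^2$ be the convex hull of the $2(d+1)$ points \[ \left\{\left(\tfrac{l}{d},\tfrac{l^2}{d^2}\right):0\le l\le d\right\}\cup\left\{\left(\tfrac{l^2}{d^2},\tfrac{l}{d}\right):0\le l\le d\right\}. \] Then for every balanced colouring $(R,B)$ of $G$, the pair $(P_2(R),P_2(B))$ lies in $D_d$.
   Context: A balanced colouring of $G$ is a partition $V(G)=R\cup B$ with $|R|=|B|$. A random walk on $G$ moves at each step to a uniformly random neighbour of its current vertex. For $S\subseteq V(G)$, $(W^S_i)_{i\ge0}$ is the random walk with $W^S_0$ uniformly random in $S$, and $P_2(S)=\mathbb P(W^S_1\in S,W^S_2\in S)$. *)

theory Defs
  imports "HOL-Probability.Probability" "Graph_Theory.Digraph"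
begin

text \<open>
  Graphs are the symmetric, loop-free digraphs without parallel arcs of the locale
  \<^locale>\<open>Digraph.graph\<close>; an undirected edge is a pair of opposite arcs.
\<close>

definition neighbours :: "('a, 'b) pre_digraph \<Rightarrow> 'a \<Rightarrow> 'a set" where
  "neighbours G v = {w. v \<rightarrow>\<^bsub>G\<^esub> w}"

definition regular :: "('a, 'b) pre_digraph \<Rightarrow> nat \<Rightarrow> bool" where
  "regular G d \<longleftrightarrow> (\<forall>v\<in>verts G. card (neighbours G v) = d)"

definition balanced_colouring :: "('a, 'b) pre_digraph \<Rightarrow> 'a set \<Rightarrow> 'a set \<Rightarrow> bool" where
  "balanced_colouring G R B \<longleftrightarrow> R \<union> B = verts G \<and> R \<inter> B = {} \<and> card R = card B"

text \<open>
  The walk is represented by the law of its initial segments: \<^term>\<open>random_walk G S n\<close> is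
  the joint distribution of \<open>[W\<^sub>0, \<dots>, W\<^sub>n]\<close>. It is meaningful only if \<open>S\<close> is finite and
  nonempty and every vertex visited has a nonempty finite neighbourhood, because
  \<^const>\<open>pmf_of_set\<close> is unspecified on empty and infinite sets.
\<close>

primrec walk_from :: "('a, 'b) pre_digraph \<Rightarrow> 'a \<Rightarrow> nat \<Rightarrow> 'a list pmf" where
  "walk_from G v 0 = return_pmf [v]"
| "walk_from G v (Suc n) =
     bind_pmf (pmf_of_set (neighbours G v)) (\<lambda>w. map_pmf (\<lambda>ws. v # ws) (walk_from G w n))"

definition random_walk :: "('a, 'b) pre_digraph \<Rightarrow> 'a set \<Rightarrow> nat \<Rightarrow> 'a list pmf" where
  "random_walk G S n = bind_pmf (pmf_of_set S) (\<lambda>v. walk_from G v n)"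

definition P2 :: "('a, 'b) pre_digraph \<Rightarrow> 'a set \<Rightarrow> real" where
  "P2 G S = measure_pmf.prob (random_walk G S 2) {W. W ! 1 \<in> S \<and> W ! 2 \<in> S}"

definition D :: "nat \<Rightarrow> (real \<times> real) set" where
  "D d = convex hull
     ({(real l / real d, (real l)\<^sup>2 / (real d)\<^sup>2) | l. l \<le> d} \<union>
      {((real l)\<^sup>2 / (real d)\<^sup>2, real l / real d) | l. l \<le> d})"

lemma D_subset_unit_square: "D d \<subseteq> {0..1} \<times> {0..1}"
  unfolding D_def
proof (rule hull_minimal)
  have "(real l)\<^sup>2 / (real d)\<^sup>2 \<le> 1" if "l \<le> d" for l
    using that by (cases "d = 0") (auto simp: divide_le_eq_1 power_mono)
  moreover have "real l / real d \<le> 1" if "l \<le> d" for l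
    using that by (cases "d = 0") (auto simp: divide_le_eq_1)
  ultimately show "{(real l / real d, (real l)\<^sup>2 / (real d)\<^sup>2) | l. l \<le> d} \<union>
      {((real l)\<^sup>2 / (real d)\<^sup>2, real l / real d) | l. l \<le> d} \<subseteq> {0..1} \<times> {0..1}"
    by auto
  show "convex ({0..1} \<times> {0..1} :: (real \<times> real) set)"
    by (intro convex_Times) auto
qed

end

theory Submission
  imports Defs
begin

text \<open>
  Reversibility turns \<open>P2 G S\<close> into the mean over \<open>v \<in> S\<close> of the square of the fraction of
  neighbours of \<open>v\<close> inside \<open>S\<close>. Let \<open>p\<close> and \<open>q\<close> be these means for \<open>R\<close> and \<open>B\<close>. Counting the
  edges between \<open>R\<close> and \<open>B\<close> from both sides shows that the unsquared fractions have a common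
  mean \<open>m \<ge> max p q\<close>. Hence \<open>(m, q)\<close> and \<open>(p, m)\<close> are convex combinations of the generating points
  of \<open>D d\<close>. The diagonal of the unit square also lies in \<open>D d\<close>, and \<open>(p, q)\<close> lies on the segment
  from \<open>(q, q)\<close> to \<open>(m, q)\<close> or on the one from \<open>(p, p)\<close> to \<open>(p, m)\<close>.
\<close>

definition nbr_frac :: "('a, 'b) pre_digraph \<Rightarrow> 'a set \<Rightarrow> 'a \<Rightarrow> real" where
  "nbr_frac G S v = real (card (neighbours G v \<inter> S)) / real (card (neighbours G v))"

lemma neighbours_subset_verts:
  assumes "graph G"
  shows "neighbours G v \<subseteq> verts G"
proof -
  interpret graph G by fact
  show ?thesis by (auto simp: neighbours_def dest: adj_in_verts)
qed

lemma finite_neighbours: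
  assumes "graph G"
  shows "finite (neighbours G v)"
proof -
  interpret graph G by fact
  show ?thesis using neighbours_subset_verts[OF assms] finite_verts by (rule finite_subset)
qed

lemma neighbours_sym:
  assumes "graph G"
  shows "w \<in> neighbours G v \<longleftrightarrow> v \<in> neighbours G w"
proof -
  interpret graph G by fact
  show ?thesis by (auto simp: neighbours_def dest: symD[OF sym_arcs[unfolded symmetric_def]])
qed

text \<open>Double counting of the arcs between \<open>S\<close> and \<open>T\<close>: by symmetry
  of adjacency, each \<open>w\<close> in \<open>T\<close> is reached once from each of its
  neighbours in \<open>S\<close>. The case \<open>T = S\<close> expresses reversibility of the walk;
  \<open>f = 1\<close> counts arcs from both ends.\<close>

lemma sum_neighbours_swap:
  fixes f :: "'a \<Rightarrow> real"
  assumes "graph G" "finite S" "finite T"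
  shows "(\<Sum>v\<in>S. \<Sum>w\<in>neighbours G v \<inter> T. f w) = (\<Sum>w\<in>T. real (card (neighbours G w \<inter> S)) * f w)"
proof -
  have "(\<Sum>v\<in>S. \<Sum>w\<in>neighbours G v \<inter> T. f w)
      = (\<Sum>v\<in>S. \<Sum>w | w \<in> T \<and> w \<in> neighbours G v. f w)"
    by (intro sum.cong) auto
  also have "\<dots> = (\<Sum>w\<in>T. \<Sum>v | v \<in> S \<and> w \<in> neighbours G v. f w)"
    using assms by (intro sum.swap_restrict)
  also have "\<dots> = (\<Sum>w\<in>T. real (card (neighbours G w \<inter> S)) * f w)"
  proof (intro sum.cong refl)
    fix w
    have "{v. v \<in> S \<and> w \<in> neighbours G v} = neighbours G w \<inter> S"
      using neighbours_sym[OF assms(1)] by blast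
    then show "(\<Sum>v | v \<in> S \<and> w \<in> neighbours G v. f w) = real (card (neighbours G w \<inter> S)) * f w"
      by simp
  qed
  finally show ?thesis .
qed

lemma prob_bind_pmf_of_set:
  assumes "finite A" "A \<noteq> {}"
  shows "measure_pmf.prob (bind_pmf (pmf_of_set A) f) X = (\<Sum>x\<in>A. measure_pmf.prob (f x) X) / card A"
proof -
  have "measure_pmf.prob (bind_pmf (pmf_of_set A) f) X
      = measure_pmf.expectation (pmf_of_set A) (\<lambda>x. measure_pmf.prob (f x) X)"
    unfolding measure_pmf_bind
    using measurable_measure_pmf[of f]
    by (intro measure_pmf.measure_bind[where N = "count_space UNIV"]) auto
  then show ?thesis using assms by (simp add: integral_pmf_of_set)
qed

lemma P2_eq_mean_nbr_frac:
  assumes G: "graph G" and reg: "regular G d" and d: "d \<ge> 1" and S: "S \<subseteq> verts G" "S \<noteq> {}"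
  shows "P2 G S = (\<Sum>v\<in>S. (nbr_frac G S v)\<^sup>2) / card S"
proof -
  interpret graph G by fact
  let ?N = "neighbours G"
  have fS: "finite S" using S finite_verts finite_subset by blast
  have card: "card (?N v) = d" if "v \<in> verts G" for v
    using reg that by (simp add: regular_def)
  have N: "finite (?N v)" "?N v \<noteq> {}" if "v \<in> verts G" for v
    using finite_neighbours[OF G] card[OF that] d by auto
  have vN: "w \<in> verts G" if "w \<in> ?N v" for v w
    using neighbours_subset_verts[OF G] that by blast
  define X where "X = {W. W ! 1 \<in> S \<and> W ! 2 \<in> S}"
  have walk2: "measure_pmf.prob (walk_from G v 2) X
      = (\<Sum>w\<in>?N v \<inter> S. nbr_frac G S w) / d" if v: "v \<in> verts G" for v
  proof -
    have "measure_pmf.prob (map_pmf (\<lambda>ws. v # ws) (walk_from G w 1)) X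
        = (if w \<in> S then nbr_frac G S w else 0)" if "w \<in> ?N v" for w
    proof -
      have w: "w \<in> verts G" using vN that .
      \<comment> \<open>Dropping the head \<open>v\<close> shifts the tested positions from 1 and 2
        to 0 and 1.\<close>
      have "measure_pmf.prob (map_pmf (\<lambda>ws. v # ws) (walk_from G w 1)) X
          = measure_pmf.prob (walk_from G w 1) {ws. ws ! 0 \<in> S \<and> ws ! 1 \<in> S}"
        by (simp add: X_def measure_map_pmf vimage_def numeral_2_eq_2)
      also have "\<dots> = (\<Sum>u\<in>?N w. indicator {u. w \<in> S \<and> u \<in> S} u) / card (?N w)"
        using N[OF w] by (simp add: prob_bind_pmf_of_set map_pmf_def bind_return_pmf measure_return_pmf
          indicator_def)
      also have "\<dots> = (if w \<in> S then nbr_frac G S w else 0)"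
        using N[OF w] by (simp add: nbr_frac_def indicator_def sum.If_cases Int_def)
      finally show ?thesis .
    qed
    then show ?thesis
      using N[OF v] card[OF v]
      by (simp add: numeral_2_eq_2 prob_bind_pmf_of_set sum.inter_restrict del: walk_from.simps(1))
  qed
  have "P2 G S = (\<Sum>v\<in>S. measure_pmf.prob (walk_from G v 2) X) / card S"
    using fS S by (simp add: P2_def random_walk_def prob_bind_pmf_of_set X_def)
  also have "(\<Sum>v\<in>S. measure_pmf.prob (walk_from G v 2) X)
      = (\<Sum>v\<in>S. \<Sum>w\<in>?N v \<inter> S. nbr_frac G S w) / d"
    using S by (subst sum_divide_distrib, intro sum.cong refl walk2) auto
  \<comment> \<open>Regrouping by the middle vertex \<open>w\<close>: the start lies in
    \<open>S\<close> for \<open>card (?N w \<inter> S)\<close> of its \<open>d\<close> neighbours,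
    which supplies the second factor \<open>nbr_frac G S w\<close>.\<close>
  also have "\<dots> = (\<Sum>w\<in>S. card (?N w \<inter> S) * nbr_frac G S w) / d"
    by (simp add: sum_neighbours_swap[OF G fS fS])
  also have "\<dots> = (\<Sum>w\<in>S. (nbr_frac G S w)\<^sup>2)"
    using S card
    by (subst sum_divide_distrib, intro sum.cong) (auto simp: nbr_frac_def power2_eq_square)
  finally show ?thesis .
qed

text \<open>By regularity, the degree inside a class is \<open>d\<close> minus the degree into the
  other class. The latter have equal sums over \<open>R\<close> and \<open>B\<close>, and the terms
  \<open>d\<close> cancel because the classes have equal size.\<close>

lemma sum_nbr_frac_balanced:
  assumes G: "graph G" and reg: "regular G d" and bal: "balanced_colouring G R B"
  shows "(\<Sum>v\<in>R. nbr_frac G R v) = (\<Sum>v\<in>B. nbr_frac G B v)"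
proof -
  interpret graph G by fact
  let ?N = "neighbours G"
  have RB: "R \<union> B = verts G" "R \<inter> B = {}" "card R = card B"
    using bal by (auto simp: balanced_colouring_def)
  have fin: "finite R" "finite B"
    using RB finite_verts by (metis finite_Un)+
  have split: "real (card (?N v \<inter> R)) + real (card (?N v \<inter> B)) = d" if "v \<in> verts G" for v
  proof -
    have "?N v = (?N v \<inter> R) \<union> (?N v \<inter> B)"
      using neighbours_subset_verts[OF G] RB by blast
    moreover have "card ((?N v \<inter> R) \<union> (?N v \<inter> B)) = card (?N v \<inter> R) + card (?N v \<inter> B)"
      using fin RB by (intro card_Un_disjoint) auto
    ultimately show ?thesis using reg that unfolding regular_def by (metis of_nat_add)
  qed
  have cross: "(\<Sum>v\<in>R. real (card (?N v \<inter> B))) = (\<Sum>v\<in>B. real (card (?N v \<inter> R)))"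
    using sum_neighbours_swap[OF G fin, of "\<lambda>_. 1"] by simp
  have "(\<Sum>v\<in>R. real (card (?N v \<inter> R))) = (\<Sum>v\<in>R. real d - real (card (?N v \<inter> B)))"
    using split RB by (intro sum.cong) (auto simp: algebra_simps)
  also have "\<dots> = (\<Sum>v\<in>B. real d - real (card (?N v \<inter> R)))"
    by (simp add: sum_subtractf cross RB)
  also have "\<dots> = (\<Sum>v\<in>B. real (card (?N v \<inter> B)))"
    using split RB by (intro sum.cong) (auto simp: algebra_simps)
  finally have eq: "(\<Sum>v\<in>R. real (card (?N v \<inter> R))) = (\<Sum>v\<in>B. real (card (?N v \<inter> B)))" .
  have frac: "nbr_frac G S v = real (card (?N v \<inter> S)) / d" if "v \<in> verts G" for S v
    using reg that by (simp add: nbr_frac_def regular_def)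
  have "(\<Sum>v\<in>S. nbr_frac G S v) = (\<Sum>v\<in>S. real (card (?N v \<inter> S))) / d" if "S \<subseteq> verts G" for S
    using that by (subst sum_divide_distrib, intro sum.cong refl frac) auto
  then show ?thesis using RB eq by (metis Un_upper1 Un_upper2)
qed

lemma convex_D: "convex (D d)"
  by (simp add: D_def)

text \<open>Swapping coordinates is linear and exchanges the two families of generators.\<close>

lemma D_swap:
  assumes "(x, y) \<in> D d"
  shows "(y, x) \<in> D d"
proof -
  have "prod.swap ` D d = D d"
    unfolding D_def
    by (subst convex_hull_linear_image)
      (auto intro!: linearI arg_cong[where f = "\<lambda>X. convex hull X"] simp: image_Un image_Collect)
  then show ?thesis using assms by (metis image_eqI swap_simp)
qed

lemma generator_in_D:
  assumes "l \<le> d"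
  shows "(real l / real d, (real l / real d)\<^sup>2) \<in> D d"
  unfolding D_def using assms by (intro hull_inc) (auto simp: power_divide)

text \<open>The endpoints (0, 0) and (1, 1) are the generators for \<open>l = 0\<close> and
  \<open>l = d\<close>; the latter needs \<open>d \<ge> 1\<close>, since 0 / 0 = 0.\<close>

lemma diagonal_in_D:
  assumes "d \<ge> 1" "0 \<le> s" "s \<le> 1"
  shows "(s, s) \<in> D d"
proof -
  have "(1 - s) *\<^sub>R (0, 0) + s *\<^sub>R (1, 1) \<in> D d"
    using generator_in_D[of 0 d] generator_in_D[of d d] assms
    by (intro convexD[OF convex_D]) auto
  then show ?thesis by simp
qed

text \<open>The pair of means is the convex combination, with equal weights, of the generators
  \<open>(f v, (f v)\<^sup>2)\<close>.\<close>

lemma mean_in_D: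
  assumes "finite S" "S \<noteq> {}" "\<And>v. v \<in> S \<Longrightarrow> \<exists>l\<le>d. f v = real l / real d"
  shows "((\<Sum>v\<in>S. f v) / card S, (\<Sum>v\<in>S. (f v)\<^sup>2) / card S) \<in> D d"
proof -
  have "(\<Sum>v\<in>S. (1 / card S) *\<^sub>R (f v, (f v)\<^sup>2)) \<in> D d"
  proof (rule convex_sum[OF assms(1) convex_D])
    show "(f v, (f v)\<^sup>2) \<in> D d" if "v \<in> S" for v
      using assms(3)[OF that] generator_in_D by auto
  qed (use assms in auto)
  moreover have "(\<Sum>v\<in>S. (1 / card S) *\<^sub>R (f v, (f v)\<^sup>2))
      = ((\<Sum>v\<in>S. f v) / card S, (\<Sum>v\<in>S. (f v)\<^sup>2) / card S)"
    by (simp add: prod_eq_iff fst_sum snd_sum sum_divide_distrib)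
  ultimately show ?thesis by simp
qed

lemma D_fill:
  assumes "d \<ge> 1" "(m, q) \<in> D d" "q \<le> p" "p \<le> m"
  shows "(p, q) \<in> D d"
proof -
  have "0 \<le> q" "q \<le> 1" using subsetD[OF D_subset_unit_square assms(2)] by auto
  then have "(q, q) \<in> D d" using diagonal_in_D assms(1) by blast
  moreover have "(p, q) \<in> closed_segment (q, q) (m, q)"
  proof (cases "m = q")
    case False
    then show ?thesis using assms(3,4)
      \<comment> \<open>The witness is the solution \<open>u\<close> of
        \<open>(1 - u) * q + u * m = p\<close>.\<close>
      by (auto simp: in_segment intro!: exI[of _ "(p - q) / (m - q)"] simp: field_simps)
  qed (use assms in auto)
  ultimately show ?thesis
    using assms(2) convex_D convex_contains_segment by blast
qed

theorem theorem1:
  fixes G :: "('a, 'b) pre_digraph" and d :: nat and R B :: "'a set"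
  assumes "Digraph.graph G"
    and "verts G \<noteq> {}"
    and "d \<ge> 1"
    and "regular G d"
    and "even (card (verts G))"
    and "balanced_colouring G R B"
  shows "(P2 G R, P2 G B) \<in> D d"
proof -
  interpret graph G by fact
  note G = assms(1) and d = assms(3) and reg = assms(4)
  have RB: "R \<union> B = verts G" "card R = card B"
    using assms(6) by (auto simp: balanced_colouring_def)
  have fin: "finite R" "finite B"
    using RB finite_verts by (metis finite_Un)+
  \<comment> \<open>Finite classes of equal size are empty together, which would leave no
    vertices.\<close>
  then have ne: "R \<noteq> {}" "B \<noteq> {}"
    using RB assms(2) by auto
  have frac: "\<exists>l\<le>d. nbr_frac G S v = real l / real d" if "v \<in> verts G" for S v
    using reg that card_mono[OF finite_neighbours[OF G], of "neighbours G v \<inter> S" v]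
    by (auto simp: nbr_frac_def regular_def)
  have P2R: "P2 G R = (\<Sum>v\<in>R. (nbr_frac G R v)\<^sup>2) / card R"
    and P2B: "P2 G B = (\<Sum>v\<in>B. (nbr_frac G B v)\<^sup>2) / card B"
    using RB(1) ne by (auto intro!: P2_eq_mean_nbr_frac[OF G reg d])
  define m where "m = (\<Sum>v\<in>R. nbr_frac G R v) / card R"
  have mB: "m = (\<Sum>v\<in>B. nbr_frac G B v) / card B"
    using sum_nbr_frac_balanced[OF G reg assms(6)] RB by (simp add: m_def)
  have R: "(m, P2 G R) \<in> D d"
    unfolding m_def P2R using RB by (intro mean_in_D fin ne frac) auto
  have B: "(m, P2 G B) \<in> D d"
    unfolding mB P2B using RB by (intro mean_in_D fin ne frac) auto
  \<comment> \<open>Squaring does not increase a number in [0, 1]; averaging then bounds both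
    \<open>P2\<close> values by \<open>m\<close>.\<close>
  have sq: "(nbr_frac G S v)\<^sup>2 \<le> nbr_frac G S v" if "v \<in> verts G" for S v
  proof -
    have "0 \<le> nbr_frac G S v" "nbr_frac G S v \<le> 1"
      using frac[OF that, of S] d by auto
    then show ?thesis by (simp add: power2_eq_square mult_left_le)
  qed
  have "P2 G R \<le> m"
    unfolding P2R m_def using RB(1) by (auto intro!: divide_right_mono sum_mono sq)
  moreover have "P2 G B \<le> m"
    unfolding P2B mB using RB(1) by (auto intro!: divide_right_mono sum_mono sq)
  \<comment> \<open>If \<open>P2 G B \<le> P2 G R\<close>, move horizontally from
    \<open>(m, P2 G B)\<close> towards the diagonal; otherwise do the same with the classes
    exchanged and reflect.\<close>
  ultimately show ?thesis
    using D_fill[OF d B] D_swap[OF D_fill[OF d R]] by (meson linear)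
qed

end
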